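(* For every $c\in\mathbb{Z}^+$, $$\{u[\mathbf{t}],\,v[\mathbf{t}] : \mathbf{t}\text{ a binary code of length }c\}=\{f_{x_1}\cdots f_{x_c}(1/2),\ f_{x_1}\cdots f_{x_c}(2/1) : x_i\in\{L,R\}\text{ for }1\le i\le c\},$$ where $f_{x_1}\cdots f_{x_c}$ denotes the composition of the maps $f_{x_1},\dots,f_{x_c}$.
   Context: Define $\tau_0,\tau_1:\mathbb{Z}^3\to\mathbb{Z}^3$ by $\tau_0([a,b,c])=[a,c,a+c]$ and $\tau_1([a,b,c])=[b,c,b+c]$. For a binary code $\mathbf{t}=x_1x_2\cdots x_k$ with $x_i\in\{0,1\}$, let $S[\mathbf{t}]=\tau_{x_k}\circ\cdots\circ\tau_{x_1}([1,2,3])$ (for the empty code, $S[\,]=[1,2,3]$). If $S[\mathbf{t}]=[a,b,c]$, set $u[\mathbf{t}]=a/b$ and $v[\mathbf{t}]=b/a$; in particular $u[\,]=1/2$ and $v[\,]=2/1$. For a positive fraction $a/b$, define $f_R(a/b)=a/b+1=(a+b)/b$ and $f_L(a/b)=a/(a+b)$. (These maps $f_L,f_R$ give a binary encoding of the Stern-Brocot tree; the right-hand set is the $c$-th generation below the vertices $1/2$ and $2/1$.) *)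

theory Defs
  imports Complex_Main
begin

type_synonym triple = "int \<times> int \<times> int"

fun tau0 :: "triple \<Rightarrow> triple" where
  "tau0 (a, b, c) = (a, c, a + c)"

fun tau1 :: "triple \<Rightarrow> triple" where
  "tau1 (a, b, c) = (b, c, b + c)"

text \<open>A binary code is a boolean list, with False for the digit 0 and True for the digit 1.
  Its first digit is applied first.\<close>

definition tau :: "bool \<Rightarrow> triple \<Rightarrow> triple" where
  "tau x = (if x then tau1 else tau0)"

definition S :: "bool list \<Rightarrow> triple" where
  "S t = fold tau t (1, 2, 3)"

definition u :: "bool list \<Rightarrow> rat" where
  "u t = (case S t of (a, b, c) \<Rightarrow> of_int a / of_int b)"

definition v :: "bool list \<Rightarrow> rat" where
  "v t = (case S t of (a, b, c) \<Rightarrow> of_int b / of_int a)"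

datatype direction = L | R

text \<open>The left map is given by a formula on numerator and denominator. It is defined on the
  reduced representation; \<open>f_L_fraction\<close> shows that on positive fractions the formula
  does not depend on the representation. Values at nonpositive rationals are irrelevant.\<close>

definition f_R :: "rat \<Rightarrow> rat" where
  "f_R q = q + 1"

definition f_L :: "rat \<Rightarrow> rat" where
  "f_L q = (case quotient_of q of (a, b) \<Rightarrow> of_int a / of_int (a + b))"

lemma f_R_fraction:
  fixes a b :: int
  assumes "a > 0" "b > 0"
  shows "f_R (of_int a / of_int b) = of_int (a + b) / of_int b"
  using assms by (simp add: f_R_def field_simps)

lemma f_L_fraction:
  fixes a b :: int
  assumes "a > 0" "b > 0"
  shows "f_L (of_int a / of_int b) = of_int a / of_int (a + b)"
proof -
  obtain p q where pq: "quotient_of (of_int a / of_int b) = (p, q)"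
    by (cases "quotient_of (of_int a / of_int b)")
  have q: "q > 0" and eq: "(of_int a / of_int b :: rat) = of_int p / of_int q"
    using quotient_of_denom_pos[OF pq] quotient_of_div[OF pq] by auto
  have cross: "(of_int a * of_int q :: rat) = of_int p * of_int b"
    using eq q assms by (simp add: field_simps)
  have "(0::rat) < of_int p / of_int q"
    using assms by (simp add: eq[symmetric])
  then have "p > 0"
    using q by (simp add: zero_less_divide_iff)
  then have "(of_int p + of_int q :: rat) \<noteq> 0" and "(of_int a + of_int b :: rat) \<noteq> 0"
    using q assms by (simp_all flip: of_int_add)
  then show ?thesis
    using cross by (simp add: f_L_def pq frac_eq_eq algebra_simps)
qed

fun f_dir :: "direction \<Rightarrow> rat \<Rightarrow> rat" where
  "f_dir L = f_L"
| "f_dir R = f_R"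

text \<open>The composition whose outermost map is the one of the first letter.\<close>

definition f_word :: "direction list \<Rightarrow> rat \<Rightarrow> rat" where
  "f_word xs = foldr f_dir xs"

end

theory Submission
  imports Defs
begin

text \<open>
  Both sides satisfy the same recursion in the length: the next set is the image of the
  current one under \<open>f_L\<close> together with its image under \<open>f_R\<close>. For the words this is
  immediate, since the outermost map of a composition belongs to the first letter.

  For the codes, every triple that arises has the form \<open>(a, b, a + b)\<close> with \<open>a\<close> and \<open>b\<close>
  positive. Hence appending a digit replaces \<open>(a, b)\<close> by \<open>(a, a + b)\<close> or \<open>(b, a + b)\<close>, and
  the four fractions made from these two pairs are \<open>f_L\<close> and \<open>f_R\<close> applied to \<open>a / b\<close> and to
  \<open>b / a\<close> (lemma \<open>code_step\<close>). The digit 1 exchanges the roles of \<open>u\<close> and \<open>v\<close>, so the recursion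
  closes only on the union of the two sets of values; for length 0 that union is
  \<open>{1/2, 2}\<close>, which is why the words start from both of these vertices.
\<close>

lemma S_form:
  obtains a b where "a > 0" "b > 0" "S t = (a, b, a + b)"
proof -
  have "\<exists>a b. a > 0 \<and> b > 0 \<and> S t = (a, b, a + b)"
  proof (induction t rule: rev_induct)
    case Nil
    show ?case by (simp add: S_def)
  next
    case (snoc x t)
    then obtain a b where "a > 0" "b > 0" "S t = (a, b, a + b)"
      by blast
    then show ?case
      by (simp add: S_def tau_def)
  qed
  with that show ?thesis by blast
qed

text \<open>Writing \<open>S t = (a, b, a + b)\<close>, each equation is the formula for \<open>f_L\<close> or \<open>f_R\<close> on the
  fraction \<open>a / b\<close> or \<open>b / a\<close>.\<close>

lemma code_step:
  "u (t @ [False]) = f_L (u t)"  "v (t @ [False]) = f_R (v t)"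
  "u (t @ [True]) = f_L (v t)"   "v (t @ [True]) = f_R (u t)"
proof -
  obtain a b where ab: "a > 0" "b > 0" and S: "S t = (a, b, a + b)"
    by (rule S_form)
  have uv: "u t = of_int a / of_int b" "v t = of_int b / of_int a"
    by (simp_all add: u_def v_def S)
  have S': "S (t @ [x]) = tau x (a, b, a + b)" for x
    using S by (simp add: S_def)
  show "u (t @ [False]) = f_L (u t)" "v (t @ [False]) = f_R (v t)"
       "u (t @ [True]) = f_L (v t)" "v (t @ [True]) = f_R (u t)"
    unfolding uv f_L_fraction[OF ab] f_L_fraction[OF ab(2,1)]
      f_R_fraction[OF ab] f_R_fraction[OF ab(2,1)]
    by (simp_all add: u_def v_def S' tau_def add.commute)
qed

definition code_values :: "nat \<Rightarrow> rat set" where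
  "code_values n = {u t | t. length t = n} \<union> {v t | t. length t = n}"

definition word_values :: "nat \<Rightarrow> rat set" where
  "word_values n = {f_word xs (1/2) | xs. length xs = n} \<union> {f_word xs (2/1) | xs. length xs = n}"

lemma word_values_Suc: "word_values (Suc n) = f_L ` word_values n \<union> f_R ` word_values n"
proof -
  have split: "{f_word xs q | xs. length xs = Suc n} =
      f_L ` {f_word xs q | xs. length xs = n} \<union> f_R ` {f_word xs q | xs. length xs = n}" for q
  proof -
    have "{f_word xs q | xs. length xs = Suc n} =
        {f_dir x (f_word xs q) | x xs. length xs = n}"
      by (force simp: f_word_def length_Suc_conv)
    also have "\<dots> = (\<Union>x\<in>{L, R}. f_dir x ` {f_word xs q | xs. length xs = n})"
      using direction.exhaust by blast
    finally show ?thesis by simp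
  qed
  show ?thesis
    unfolding word_values_def split by blast
qed

lemma code_values_Suc: "code_values (Suc n) = f_L ` code_values n \<union> f_R ` code_values n"
proof -
  have split: "{g t | t. length t = Suc n} =
      {g (t @ [False]) | t. length t = n} \<union> {g (t @ [True]) | t. length t = n}"
    for g :: "bool list \<Rightarrow> rat"
  proof -
    have "{g t | t. length t = Suc n} = {g (t @ [x]) | t x. length t = n}"
      by (force simp: length_Suc_conv_rev)
    also have "\<dots> = {g (t @ [False]) | t. length t = n} \<union> {g (t @ [True]) | t. length t = n}"
      by (auto; metis)
    finally show ?thesis .
  qed
  show ?thesis
    unfolding code_values_def split code_step by blast
qed

lemma code_values_eq_word_values: "code_values n = word_values n"
proof (induction n)
  case 0
  show ?case
    by (simp add: code_values_def word_values_def u_def v_def S_def f_word_def)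
next
  case (Suc n)
  then show ?case
    by (simp add: code_values_Suc word_values_Suc)
qed

theorem mainTheorem3:
  fixes c :: nat
  assumes "c > 0"
  shows "{u t | t. length t = c} \<union> {v t | t. length t = c} =
         {f_word xs (1/2) | xs. length xs = c} \<union> {f_word xs (2/1) | xs. length xs = c}"
  using code_values_eq_word_values[of c]
  unfolding code_values_def word_values_def .

end
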